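(* Let $q\geq 2$ be an integer, let $p=1/q$, and let $f(w):=w^p$ for $w\in[0,+\infty)$. Let $\delta>0$ and let $g$ be the smoothing of $f$ associated with $\delta$. Then $g(w)\leq f(w)$ for all $w\in[0,+\infty)$.
   Context: For $f(w)=w^p$ with $0<p<1$ and $\delta>0$, the smoothing $g$ of $f$ associated with $\delta$ is defined by $g(w):=w^p$ for $w\in[\delta,+\infty)$, and $g(w):=Aw^3+Bw^2+Cw$ for $w\in[0,\delta]$, where $$A=\tfrac12\delta^{p-3}(p^2-3p+2),\qquad B=-\delta^{p-2}(p^2-4p+3),\qquad C=\tfrac12\delta^{p-1}(p^2-5p+6).$$ (These are the unique constants for which the cubic $Aw^3+Bw^2+Cw$ agrees with $f$ in value, first derivative and second derivative at $w=\delta$.) *)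

theory Defs
  imports Complex_Main
begin

definition smoothing_A :: "real \<Rightarrow> real \<Rightarrow> real" where
  "smoothing_A p \<delta> = 1/2 * \<delta> powr (p - 3) * (p^2 - 3*p + 2)"

definition smoothing_B :: "real \<Rightarrow> real \<Rightarrow> real" where
  "smoothing_B p \<delta> = - (\<delta> powr (p - 2) * (p^2 - 4*p + 3))"

definition smoothing_C :: "real \<Rightarrow> real \<Rightarrow> real" where
  "smoothing_C p \<delta> = 1/2 * \<delta> powr (p - 1) * (p^2 - 5*p + 6)"

(* The smoothing of w \<mapsto> w powr p on [0, \<infinity>), meant for 0 < p < 1 and \<delta> > 0.
   Values at w < 0 are irrelevant. The two branches agree at w = \<delta> (smoothing_cubic_at_delta). *)
definition smoothing :: "real \<Rightarrow> real \<Rightarrow> real \<Rightarrow> real" where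
  "smoothing p \<delta> w =
     (if \<delta> \<le> w then w powr p
      else smoothing_A p \<delta> * w^3 + smoothing_B p \<delta> * w^2 + smoothing_C p \<delta> * w)"

lemma smoothing_cubic_at_delta:
  assumes "\<delta> > 0"
  shows "smoothing_A p \<delta> * \<delta>^3 + smoothing_B p \<delta> * \<delta>^2 + smoothing_C p \<delta> * \<delta> = \<delta> powr p"
proof -
  have *: "\<delta> powr (p - 3) = \<delta> powr p / \<delta>^3" "\<delta> powr (p - 2) = \<delta> powr p / \<delta>^2"
    "\<delta> powr (p - 1) = \<delta> powr p / \<delta>"
    using assms by (simp_all add: powr_diff)
  have "smoothing_A p \<delta> * \<delta>^3 = 1/2 * (p^2 - 3*p + 2) * \<delta> powr p"
    "smoothing_B p \<delta> * \<delta>^2 = - ((p^2 - 4*p + 3) * \<delta> powr p)"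
    "smoothing_C p \<delta> * \<delta> = 1/2 * (p^2 - 5*p + 6) * \<delta> powr p"
    using assms by (simp_all add: smoothing_A_def smoothing_B_def smoothing_C_def *)
  then show ?thesis by (simp add: algebra_simps)
qed

end

theory Submission
  imports Defs
begin

text \<open>On \<open>[0, \<delta>]\<close> the smoothing is \<open>w * T w\<close>, where \<open>T\<close> is the second-order Taylor polynomial
  of \<open>w powr (p - 1)\<close> at \<open>\<delta>\<close>. The third derivative of \<open>w powr (p - 1)\<close> is negative, so the Taylor
  remainder at \<open>w < \<delta>\<close> is positive.\<close>

lemma powr_ge_Taylor_2:
  fixes s w \<delta> :: real
  assumes "s \<le> 0" "0 < w" "w < \<delta>"
  shows "\<delta> powr s + s * \<delta> powr (s - 1) * (w - \<delta>)
           + s * (s - 1) / 2 * \<delta> powr (s - 2) * (w - \<delta>)^2 \<le> w powr s"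
proof -
  \<comment> \<open>\<open>D m\<close> is the \<open>m\<close>-th derivative of
    \<open>x powr s\<close>, with a falling factorial as coefficient.\<close>
  define D where "D m x = (\<Prod>i<m. s - real i) * x powr (s - real m)" for m :: nat and x :: real
  have "\<forall>m x. m < 3 \<and> w \<le> x \<and> x \<le> \<delta> \<longrightarrow> (D m has_real_derivative D (Suc m) x) (at x)"
  proof (intro allI impI)
    fix m :: nat and x :: real
    assume "m < 3 \<and> w \<le> x \<and> x \<le> \<delta>"
    then have "0 < x"
      using assms by simp
    then show "(D m has_real_derivative D (Suc m) x) (at x)"
      unfolding D_def
      by (auto intro!: derivative_eq_intros simp: algebra_simps)
  qed
  moreover have "D 0 = (\<lambda>x. x powr s)"
    by (simp add: D_def fun_eq_iff)
  ultimately obtain t where t: "w < t"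
    and w: "w powr s = (\<Sum>m<3. D m \<delta> / fact m * (w - \<delta>)^m) + D 3 t / fact 3 * (w - \<delta>)^3"
    using Taylor_down[of 3 D "\<lambda>x. x powr s" w \<delta> \<delta>] assms by auto
  \<comment> \<open>This is the coefficient of \<open>D 3\<close>; an odd number of nonpositive
    factors fixes its sign.\<close>
  have "s * (s - 1) * (s - 2) \<le> 0"
    using assms by (intro mult_nonneg_nonpos mult_nonpos_nonpos) auto
  then have "D 3 t \<le> 0"
    by (simp add: D_def numeral_3_eq_3 mult_nonpos_nonneg)
  moreover have "(w - \<delta>)^3 \<le> 0"
    using assms by (simp add: power_le_zero_eq)
  ultimately have "0 \<le> D 3 t / fact 3 * (w - \<delta>)^3"
    by (intro mult_nonpos_nonpos divide_nonpos_nonneg) auto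
  then show ?thesis
    using w by (simp add: D_def numeral_3_eq_3 numeral_2_eq_2)
qed

text \<open>The cubic has no constant term, so dividing it by \<open>w\<close> leaves a quadratic
  that still matches \<open>w powr (p - 1)\<close> to second order at \<open>\<delta>\<close>. The
  exponents stay unsimplified to fit \<open>powr_ge_Taylor_2\<close> at
  \<open>s = p - 1\<close>.\<close>

lemma smoothing_eq_Taylor:
  assumes "0 < \<delta>" "w < \<delta>"
  shows "smoothing p \<delta> w = w * (\<delta> powr (p - 1) + (p - 1) * \<delta> powr (p - 1 - 1) * (w - \<delta>)
           + (p - 1) * (p - 1 - 1) / 2 * \<delta> powr (p - 1 - 2) * (w - \<delta>)^2)"
proof -
  \<comment> \<open>With the lowest power of \<open>\<delta>\<close> as a common factor, the claim
    becomes a polynomial identity.\<close>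
  define d where "d = \<delta> powr (p - 3)"
  have d: "\<delta> powr (p - 1) = d * \<delta>^2" "\<delta> powr (p - 2) = d * \<delta>"
    using assms by (simp_all add: d_def powr_diff power2_eq_square power3_eq_cube)
  have "p - 1 - 1 = p - 2" "p - 1 - 2 = p - 3"
    by simp_all
  then show ?thesis
    using assms
    by (simp add: smoothing_def smoothing_A_def smoothing_B_def smoothing_C_def d d_def[symmetric]
        field_simps power2_eq_square power3_eq_cube)
qed

lemma smoothing_le_powr:
  assumes "p \<le> 1" "0 < \<delta>" "0 \<le> w"
  shows "smoothing p \<delta> w \<le> w powr p"
\<comment> \<open>The point \<open>w = 0\<close>, where \<open>w powr (p - 1)\<close> is singular,
  is set apart: there both sides are 0. For \<open>w \<ge> \<delta>\<close> they coincide by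
  definition.\<close>
proof (cases "0 < w \<and> w < \<delta>")
  case True
  then have "smoothing p \<delta> w \<le> w * w powr (p - 1)"
    using powr_ge_Taylor_2[of "p - 1" w \<delta>] assms
    by (simp only: smoothing_eq_Taylor) (intro mult_left_mono, auto)
  also have "\<dots> = w powr p"
    using True by (simp add: powr_diff)
  finally show ?thesis .
next
  case False
  then show ?thesis
    using assms by (auto simp: smoothing_def)
qed

theorem theorem9:
  fixes q :: nat and p \<delta> :: real
  assumes "q \<ge> 2"
    and "p = 1 / real q"
    and "\<delta> > 0"
  shows "\<forall>w \<in> {0..}. smoothing p \<delta> w \<le> w powr p"
  using assms by (auto intro!: smoothing_le_powr)

end
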